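(* Consider the functional Berkson logistic regression model with known error variance $\tau^2$ and nonrandom surrogate regressors $X^{\rm obs}_1,\dots,X^{\rm obs}_N\in\mathbb{R}$. If not all of $X^{\rm obs}_1,\dots,X^{\rm obs}_N$ are equal, then the model is identifiable; that is, if $\vec\beta^{(1)},\vec\beta^{(2)}\in\mathbb{R}^2$ are two parameter values for which the distributions of the observations $(Y_1,\dots,Y_N)$ coincide, then $\vec\beta^{(1)}=\vec\beta^{(2)}$.
   Context: Functional Berkson logistic regression model: $X^{\rm obs}_1,\dots,X^{\rm obs}_N$ are given (nonrandom) real numbers. The true regressors are $X_n=X^{\rm obs}_n+U_n$ with $U_n\sim N(0,\tau^2)$, $\tau^2\ge 0$ (for $\tau^2=0$, $U_n=0$ almost surely). The response $Y_n\in\{0,1\}$ satisfies $$P(Y_n=1\mid X^{\rm obs}_n,X_n)=\frac{\exp(\beta_0+\beta_1X_n)}{1+\exp(\beta_0+\beta_1X_n)}.$$ The trials $n=1,\dots,N$ are independent. The pairs $(X^{\rm obs}_n,Y_n)$, $n=1,\dots,N$, are observed; the $X_n$ are not. The unknown parameter is $\vec\beta=(\beta_0,\beta_1)^\top\in\mathbb{R}^2$; here $\tau^2$ is known (fixed). The model is identifiable if different parameter values $\vec\beta$ give different distributions of the observations. *)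

theory Defs
  imports "HOL-Probability.Probability"
begin

definition logistic :: "real \<Rightarrow> real" where
  "logistic t = exp t / (1 + exp t)"

text \<open>Normal law with mean 0 and variance \<open>v \<ge> 0\<close>; for \<open>v = 0\<close> the library's
  \<open>normal_density\<close> is not a probability density, so that case is stated separately.\<close>

definition centred_normal :: "'a measure \<Rightarrow> ('a \<Rightarrow> real) \<Rightarrow> real \<Rightarrow> bool" where
  "centred_normal M U v \<longleftrightarrow>
     (if v = 0 then AE \<omega> in M. U \<omega> = 0
      else distributed M lborel U (normal_density 0 (sqrt v)))"

text \<open>A version of the conditional probability \<open>P(A | X)\<close>, i.e. given the sigma-algebra
  generated by \<open>X\<close>.\<close>

definition cond_prob_given :: "'a measure \<Rightarrow> 'a set \<Rightarrow> ('a \<Rightarrow> real) \<Rightarrow> 'a \<Rightarrow> real" where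
  "cond_prob_given M A X = real_cond_exp M (vimage_algebra (space M) X borel) (indicator A)"

text \<open>The parameter \<open>\<beta>\<close> is the pair \<open>(\<beta>\<^sub>0, \<beta>\<^sub>1)\<close>, and \<open>\<tau>2\<close> is the error variance.
  As \<open>xobs\<close> is nonrandom, conditioning on it adds nothing to conditioning on the true
  regressor. Independence is that of the trials, i.e. of the pairs of error and response
  (equivalently, of true regressor and response).\<close>

locale berkson_logistic = prob_space M
  for M :: "'a measure" and N :: nat and xobs :: "nat \<Rightarrow> real" and \<tau>2 :: real
    and \<beta> :: "real \<times> real" and U :: "nat \<Rightarrow> 'a \<Rightarrow> real" and Y :: "nat \<Rightarrow> 'a \<Rightarrow> nat" +
  assumes U_measurable: "n \<in> {1..N} \<Longrightarrow> U n \<in> borel_measurable M"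
    and Y_measurable: "n \<in> {1..N} \<Longrightarrow> Y n \<in> measurable M (count_space {0, 1})"
    and error_normal: "n \<in> {1..N} \<Longrightarrow> centred_normal M (U n) \<tau>2"
    and response: "n \<in> {1..N} \<Longrightarrow>
      AE \<omega> in M. cond_prob_given M {\<omega> \<in> space M. Y n \<omega> = 1} (\<lambda>\<omega>. xobs n + U n \<omega>) \<omega>
        = logistic (fst \<beta> + snd \<beta> * (xobs n + U n \<omega>))"
    and trials_indep:
      "indep_vars (\<lambda>_. borel \<Otimes>\<^sub>M count_space {0, 1}) (\<lambda>n \<omega>. (U n \<omega>, Y n \<omega>)) {1..N}"

text \<open>Joint law of \<open>(Y\<^sub>1, \<dots>, Y\<^sub>N)\<close>; the nonrandom \<open>xobs\<close> carries no further information.\<close>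

definition observation_law :: "'a measure \<Rightarrow> nat \<Rightarrow> (nat \<Rightarrow> 'a \<Rightarrow> nat) \<Rightarrow> (nat \<Rightarrow> nat) measure" where
  "observation_law M N Y =
     distr M (PiM {1..N} (\<lambda>_. count_space {0, 1})) (\<lambda>\<omega>. \<lambda>n\<in>{1..N}. Y n \<omega>)"

end

theory Submission
  imports Defs
begin

text \<open>For \<open>\<tau>\<^sup>2 > 0\<close>, \<open>P(Y\<^sub>n = 1)\<close> is the average of \<open>logistic (\<beta>\<^sub>0 + \<beta>\<^sub>1 y)\<close> against the normal density
  centred at \<open>xobs n\<close>. For two parameters with distinct slopes, the difference \<open>h\<close> of the integrands
  changes sign exactly once, say at \<open>c\<close>. As the ratio of the normal densities centred at \<open>b > a\<close>
  is strictly increasing in \<open>y\<close>, the average of \<open>h\<close> cannot vanish at both \<open>a\<close> and \<open>b\<close>: some linear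
  combination of the two averages has an integrand that is positive off \<open>c\<close>. For equal slopes
  \<open>h\<close> has constant sign.\<close>

text \<open>The case \<open>v = 0\<close> is separate because \<open>normal_density\<close> with
  standard deviation 0 is identically 0, so the integral would give 0 instead of the value at
  \<open>x\<close>.\<close>

definition response_prob :: "real \<Rightarrow> real \<times> real \<Rightarrow> real \<Rightarrow> real" where
  "response_prob v \<beta> x =
     (if v = 0 then logistic (fst \<beta> + snd \<beta> * x)
      else \<integral>y. normal_density x (sqrt v) y * logistic (fst \<beta> + snd \<beta> * y) \<partial>lborel)"

lemma logistic_bounds: "0 < logistic t" "logistic t < 1"
  using exp_gt_zero[of t] unfolding logistic_def by (auto simp del: exp_gt_zero)

lemma logistic_less_iff [simp]: "logistic s < logistic t \<longleftrightarrow> s < t"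
proof -
  have "1 + exp s > 0" "1 + exp t > 0" by (simp_all add: add_pos_pos)
  then show ?thesis
    unfolding logistic_def by (simp add: frac_less_eq divide_less_0_iff field_simps)
qed

lemma logistic_eq_iff [simp]: "logistic s = logistic t \<longleftrightarrow> s = t"
  by (metis less_irrefl linorder_less_linear logistic_less_iff)

lemma logistic_measurable [measurable]: "logistic \<in> borel_measurable borel"
  unfolding logistic_def by measurable

lemma integrable_normal_logistic:
  assumes "\<sigma> > 0"
  shows "integrable lborel (\<lambda>y. normal_density \<mu> \<sigma> y * logistic (\<beta>0 + \<beta>1 * y))"
proof (rule Bochner_Integration.integrable_bound)
  show "integrable lborel (normal_density \<mu> \<sigma>)"
    using assms by (rule integrable_normal_density)
  show "AE y in lborel. norm (normal_density \<mu> \<sigma> y * logistic (\<beta>0 + \<beta>1 * y))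
      \<le> norm (normal_density \<mu> \<sigma> y)"
    using logistic_bounds by (auto simp: abs_mult less_imp_le intro!: mult_left_le)
qed measurable

lemma integral_pos_except_point:
  fixes g :: "real \<Rightarrow> real"
  assumes "integrable lborel g" and pos: "\<And>y. y \<noteq> c \<Longrightarrow> g y > 0"
  shows "integral\<^sup>L lborel g > 0"
proof -
  have not_c: "AE y in lborel. y \<noteq> c"
    by (rule AE_lborel_singleton)
  then have nonneg: "AE y in lborel. 0 \<le> g y"
    by eventually_elim (use pos in \<open>auto intro: less_imp_le\<close>)
  have "integral\<^sup>L lborel g \<noteq> 0"
  proof
    assume "integral\<^sup>L lborel g = 0"
    then have "AE y in lborel. g y = 0"
      using integral_nonneg_eq_0_iff_AE[OF assms(1) nonneg] by simp
    \<comment> \<open>A zero integral would force \<open>g = 0\<close> almost everywhere although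
      \<open>g > 0\<close> off \<open>c\<close>; the whole line would then be a null set.\<close>
    with not_c have "AE y in (lborel :: real measure). False"
      by eventually_elim (use pos in force)
    then show False
      using AE_iff_measurable[of UNIV "lborel :: real measure" "\<lambda>_. False"] by simp
  qed
  with integral_nonneg_AE[OF nonneg] show ?thesis by simp
qed

text \<open>The monotone likelihood ratio in cross-multiplied form. The sums of squares in the
  exponents differ by \<open>2 * (y - c) * (b - a)\<close>. The sign condition on a product lets one
  statement serve both sides of \<open>c\<close>, by swapping \<open>a\<close> and
  \<open>b\<close>.\<close>

lemma normal_density_mult_less:
  assumes "\<sigma> > 0" "(y - c) * (b - a) > 0"
  shows "normal_density b \<sigma> c * normal_density a \<sigma> y < normal_density a \<sigma> c * normal_density b \<sigma> y"
proof -
  have "- (c - b)\<^sup>2 + - (y - a)\<^sup>2 < - (c - a)\<^sup>2 + - (y - b)\<^sup>2"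
    using assms(2) by (simp add: power2_eq_square algebra_simps)
  then have "(- (c - b)\<^sup>2 + - (y - a)\<^sup>2) / (2 * \<sigma>\<^sup>2) < (- (c - a)\<^sup>2 + - (y - b)\<^sup>2) / (2 * \<sigma>\<^sup>2)"
    using assms(1) by (intro divide_strict_right_mono) simp_all
  then have "exp (- (c - b)\<^sup>2 / (2 * \<sigma>\<^sup>2)) * exp (- (y - a)\<^sup>2 / (2 * \<sigma>\<^sup>2))
      < exp (- (c - a)\<^sup>2 / (2 * \<sigma>\<^sup>2)) * exp (- (y - b)\<^sup>2 / (2 * \<sigma>\<^sup>2))"
    by (simp only: exp_add[symmetric] add_divide_distrib[symmetric] exp_less_cancel_iff)
  then have "(1 / sqrt (2 * pi * \<sigma>\<^sup>2))\<^sup>2 * (exp (- (c - b)\<^sup>2 / (2 * \<sigma>\<^sup>2)) * exp (- (y - a)\<^sup>2 / (2 * \<sigma>\<^sup>2)))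
      < (1 / sqrt (2 * pi * \<sigma>\<^sup>2))\<^sup>2 * (exp (- (c - a)\<^sup>2 / (2 * \<sigma>\<^sup>2)) * exp (- (y - b)\<^sup>2 / (2 * \<sigma>\<^sup>2)))"
    using assms(1) by (intro mult_strict_left_mono) simp_all
  then show ?thesis
    unfolding normal_density_def power2_eq_square[of "1 / _"] by (simp only: mult_ac)
qed

text \<open>One-sided, so that exchanging \<beta> and \<gamma> later yields equality of the
  slopes.\<close>

lemma response_prob_slope_not_less:
  assumes "v > 0" "a < b"
    and eq: "\<And>x. x \<in> {a, b} \<Longrightarrow> response_prob v \<beta> x = response_prob v \<gamma> x"
  shows "\<not> snd \<gamma> < snd \<beta>"
proof
  assume slope: "snd \<gamma> < snd \<beta>"
  define \<sigma> where "\<sigma> = sqrt v"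
  have \<sigma>: "\<sigma> > 0" using assms(1) by (simp add: \<sigma>_def)
  define h where "h y = logistic (fst \<beta> + snd \<beta> * y) - logistic (fst \<gamma> + snd \<gamma> * y)" for y
  \<comment> \<open>The two linear predictors meet at \<open>c\<close>; since
    \<open>logistic\<close> is strictly increasing, \<open>h\<close> has the sign of
    \<open>y - c\<close>.\<close>
  define c where "c = (fst \<gamma> - fst \<beta>) / (snd \<beta> - snd \<gamma>)"
  have cross: "(fst \<beta> + snd \<beta> * y) - (fst \<gamma> + snd \<gamma> * y) = (snd \<beta> - snd \<gamma>) * (y - c)" for y
    using slope by (simp add: c_def field_simps)
  have h_int: "integrable lborel (\<lambda>y. normal_density x \<sigma> y * h y)" for x
    unfolding h_def right_diff_distrib
    by (intro Bochner_Integration.integrable_diff integrable_normal_logistic \<sigma>)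
  have h0: "(\<integral>y. normal_density x \<sigma> y * h y \<partial>lborel) = 0" if "x \<in> {a, b}" for x
    using eq[OF that] assms(1) integrable_normal_logistic[OF \<sigma>]
    by (simp add: h_def right_diff_distrib response_prob_def \<sigma>_def[symmetric])
  \<comment> \<open>The weights are the densities at \<open>c\<close>, chosen so that the factor
    multiplying \<open>h\<close> in \<open>g_eq\<close> also vanishes at \<open>c\<close>. By the
    likelihood ratio it changes sign there in the same direction as \<open>h\<close>, so the product
    is positive on both sides.\<close>
  define g where "g = (\<lambda>y. normal_density a \<sigma> c * (normal_density b \<sigma> y * h y)
      - normal_density b \<sigma> c * (normal_density a \<sigma> y * h y))"
  have g_eq: "g y = (normal_density a \<sigma> c * normal_density b \<sigma> y
      - normal_density b \<sigma> c * normal_density a \<sigma> y) * h y" for y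
    by (simp add: g_def algebra_simps)
  have "integral\<^sup>L lborel g > 0"
  proof (rule integral_pos_except_point)
    show "integrable lborel g"
      unfolding g_def
      by (intro Bochner_Integration.integrable_diff Bochner_Integration.integrable_mult_right h_int)
    fix y assume "y \<noteq> c"
    then consider "y > c" | "y < c" by linarith
    then show "g y > 0"
    proof cases
      case 1
      then have "(snd \<beta> - snd \<gamma>) * (y - c) > 0" using slope by simp
      then have "h y > 0" using cross[of y] by (simp add: h_def)
      moreover have "(y - c) * (b - a) > 0" using 1 assms(2) by simp
      ultimately show ?thesis
        unfolding g_eq using normal_density_mult_less[OF \<sigma>, of y c b a] by simp
    next
      case 2
      then have "(snd \<beta> - snd \<gamma>) * (y - c) < 0" using slope by (simp add: mult_pos_neg)
      then have "h y < 0" using cross[of y] by (simp add: h_def)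
      moreover have "(y - c) * (a - b) > 0" using 2 assms(2) by (simp add: mult_neg_neg)
      ultimately show ?thesis
        unfolding g_eq using normal_density_mult_less[OF \<sigma>, of y c a b]
        by (intro mult_neg_neg) simp_all
    qed
  qed
  moreover have "integral\<^sup>L lborel g = 0"
    unfolding g_def using h0 h_int by simp
  ultimately show False by simp
qed

text \<open>With a common slope the predictors differ by a constant, so the integrands are strictly
  ordered at every \<open>y\<close> and a single \<open>x\<close> gives the contradiction.\<close>

lemma response_prob_intercept_not_less:
  assumes "v > 0" "response_prob v \<beta> x = response_prob v \<gamma> x" "snd \<beta> = snd \<gamma>"
  shows "\<not> fst \<gamma> < fst \<beta>"
proof
  assume less: "fst \<gamma> < fst \<beta>"
  define g where "g = (\<lambda>y. normal_density x (sqrt v) y * logistic (fst \<beta> + snd \<beta> * y)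
      - normal_density x (sqrt v) y * logistic (fst \<gamma> + snd \<gamma> * y))"
  have sqrt_pos: "sqrt v > 0" using assms(1) by simp
  have "integral\<^sup>L lborel g > 0"
  proof (rule integral_pos_except_point)
    show "integrable lborel g"
      unfolding g_def
      by (intro Bochner_Integration.integrable_diff integrable_normal_logistic sqrt_pos)
    show "g y > 0" for y
      using less assms(3) normal_density_pos[OF sqrt_pos, of x y] by (simp add: g_def)
  qed
  moreover have "integral\<^sup>L lborel g = 0"
    using assms(1,2) integrable_normal_logistic[OF sqrt_pos]
    by (simp add: g_def response_prob_def)
  ultimately show False by simp
qed

lemma response_prob_inject:
  assumes "v \<ge> 0" "a \<noteq> b"
    and eq: "\<And>x. x \<in> {a, b} \<Longrightarrow> response_prob v \<beta> x = response_prob v \<gamma> x"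
  shows "\<beta> = \<gamma>"
proof (cases "v = 0")
  case True
  then have lin: "fst \<beta> + snd \<beta> * a = fst \<gamma> + snd \<gamma> * a" "fst \<beta> + snd \<beta> * b = fst \<gamma> + snd \<gamma> * b"
    using eq[of a] eq[of b] by (simp_all add: response_prob_def)
  \<comment> \<open>Without error, injectivity of \<open>logistic\<close> leaves two affine
    functions that agree at \<open>a\<close> and \<open>b\<close>; subtracting the equations
    isolates the slope.\<close>
  then have "(snd \<beta> - snd \<gamma>) * (a - b) = 0" by (simp add: algebra_simps)
  with assms(2) lin show ?thesis by (simp add: prod_eq_iff)
next
  case False
  with assms(1) have v: "v > 0" by simp
  \<comment> \<open>The slope lemma needs ordered points and is applied in both directions, hence
    \<open>min\<close>, \<open>max\<close> and the symmetric copy.\<close>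
  have eq': "response_prob v \<beta> x = response_prob v \<gamma> x" "response_prob v \<gamma> x = response_prob v \<beta> x"
    if "x \<in> {min a b, max a b}" for x
    using eq that by (auto simp: min_def max_def split: if_splits)
  have "min a b < max a b" using assms(2) by auto
  from response_prob_slope_not_less[OF v this] eq' have slope: "snd \<beta> = snd \<gamma>"
    by (meson linorder_neqE)
  moreover have "fst \<beta> = fst \<gamma>"
    using response_prob_intercept_not_less[OF v] slope eq[of a]
    by (metis insertI1 linorder_neqE)
  ultimately show ?thesis by (simp add: prod_eq_iff)
qed

context berkson_logistic
begin

lemma response_event [measurable]:
  assumes "n \<in> {1..N}"
  shows "{\<omega> \<in> space M. Y n \<omega> = 1} \<in> events"
proof -
  have "Y n -` {1} \<inter> space M \<in> events"
    using Y_measurable[OF assms] by (rule measurable_sets) simp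
  moreover have "Y n -` {1} \<inter> space M = {\<omega> \<in> space M. Y n \<omega> = 1}" by auto
  ultimately show ?thesis by simp
qed

text \<open>The tower property: a conditional probability given the true regressor integrates to the
  unconditional one.\<close>

lemma prob_response_eq_expectation:
  assumes n: "n \<in> {1..N}"
  shows "prob {\<omega> \<in> space M. Y n \<omega> = 1}
    = expectation (\<lambda>\<omega>. logistic (fst \<beta> + snd \<beta> * (xobs n + U n \<omega>)))"
proof -
  define X where "X = (\<lambda>\<omega>. xobs n + U n \<omega>)"
  have X [measurable]: "X \<in> borel_measurable M"
    unfolding X_def using U_measurable[OF n] by measurable
  define A where "A = {\<omega> \<in> space M. Y n \<omega> = 1}"
  have A [measurable]: "A \<in> events" unfolding A_def by (rule response_event[OF n])
  define F where "F = vimage_algebra (space M) X borel"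
  have "subalgebra M F"
    unfolding subalgebra_def F_def
    using X by (auto simp: sets_vimage_algebra2 measurable_sets)
  then interpret finite_measure_subalgebra M F
    by unfold_locales
  have cond_exp: "AE \<omega> in M. real_cond_exp M F (indicator A) \<omega> = logistic (fst \<beta> + snd \<beta> * X \<omega>)"
    using response[OF n] by (simp only: cond_prob_given_def X_def A_def F_def)
  have "prob A = expectation (real_cond_exp M F (indicator A))"
    by (subst real_cond_exp_int(2)) (auto simp: integrable_indicator_iff less_top[symmetric])
  also have "\<dots> = expectation (\<lambda>\<omega>. logistic (fst \<beta> + snd \<beta> * X \<omega>))"
    using cond_exp by (intro integral_cong_AE) auto
  finally show ?thesis by (simp add: A_def X_def)
qed

lemma prob_response:
  assumes n: "n \<in> {1..N}" and "\<tau>2 \<ge> 0"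
  shows "prob {\<omega> \<in> space M. Y n \<omega> = 1} = response_prob \<tau>2 \<beta> (xobs n)"
proof (cases "\<tau>2 = 0")
  case True
  then have U0: "AE \<omega> in M. U n \<omega> = 0"
    using error_normal[OF n] by (simp add: centred_normal_def)
  note [measurable] = U_measurable[OF n]
  have "expectation (\<lambda>\<omega>. logistic (fst \<beta> + snd \<beta> * (xobs n + U n \<omega>)))
      = expectation (\<lambda>\<omega>. logistic (fst \<beta> + snd \<beta> * xobs n))"
    using U0 by (intro integral_cong_AE) auto
  also have "\<dots> = logistic (fst \<beta> + snd \<beta> * xobs n)"
    by (simp add: prob_space)
  finally show ?thesis
    unfolding prob_response_eq_expectation[OF n] using True by (simp add: response_prob_def)
next
  case False
  then have "distributed M lborel (U n) (normal_density 0 (sqrt \<tau>2))"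
    using error_normal[OF n] by (simp add: centred_normal_def)
  \<comment> \<open>Scaling by 1 and shifting by \<open>xobs n\<close> moves the mean of the error
    law to the surrogate value; the expectation then becomes an integral against this
    density.\<close>
  from normal_density_affine[OF this, of 1 "xobs n"] False assms(2)
  have "distributed M lborel (\<lambda>\<omega>. xobs n + U n \<omega>) (normal_density (xobs n) (sqrt \<tau>2))"
    by simp
  from distributed_integral[OF this, of "\<lambda>y. logistic (fst \<beta> + snd \<beta> * y)"]
  show ?thesis
    unfolding prob_response_eq_expectation[OF n] using False by (simp add: response_prob_def)
qed

text \<open>Passes from the joint law to a single trial: the preimage of the cylinder set under the
  response vector is the event that trial \<open>n\<close> responds with 1.\<close>

lemma measure_observation_law:
  assumes n: "n \<in> {1..N}"
  shows "measure (observation_law M N Y) {f \<in> space (PiM {1..N} (\<lambda>_. count_space {0, 1})). f n = 1}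
    = prob {\<omega> \<in> space M. Y n \<omega> = 1}"
proof -
  let ?P = "PiM {1..N} (\<lambda>_. count_space {0, 1 :: nat})"
  have meas: "(\<lambda>\<omega>. \<lambda>n\<in>{1..N}. Y n \<omega>) \<in> measurable M ?P"
    by (intro measurable_restrict Y_measurable)
  have "(\<lambda>f. f n) -` {1} \<inter> space ?P \<in> sets ?P"
    using measurable_component_singleton[OF n] by (rule measurable_sets) simp
  moreover have "(\<lambda>f. f n) -` {1} \<inter> space ?P = {f \<in> space ?P. f n = 1}" by auto
  ultimately have "{f \<in> space ?P. f n = 1} \<in> sets ?P" by simp
  then have "measure (observation_law M N Y) {f \<in> space ?P. f n = 1}
      = prob ((\<lambda>\<omega>. \<lambda>n\<in>{1..N}. Y n \<omega>) -` {f \<in> space ?P. f n = 1} \<inter> space M)"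
    unfolding observation_law_def using meas by (intro measure_distr)
  also have "(\<lambda>\<omega>. \<lambda>n\<in>{1..N}. Y n \<omega>) -` {f \<in> space ?P. f n = 1} \<inter> space M
      = {\<omega> \<in> space M. Y n \<omega> = 1}"
    using n measurable_space[OF meas] by auto
  finally show ?thesis .
qed

end

theorem theorem1:
  fixes M1 :: "'a measure" and M2 :: "'b measure"
    and N :: nat and xobs :: "nat \<Rightarrow> real" and \<tau>2 :: real
    and \<beta>1 \<beta>2 :: "real \<times> real"
    and U1 :: "nat \<Rightarrow> 'a \<Rightarrow> real" and Y1 :: "nat \<Rightarrow> 'a \<Rightarrow> nat"
    and U2 :: "nat \<Rightarrow> 'b \<Rightarrow> real" and Y2 :: "nat \<Rightarrow> 'b \<Rightarrow> nat"
  assumes "\<tau>2 \<ge> 0"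
    and "\<not> (\<forall>i\<in>{1..N}. \<forall>j\<in>{1..N}. xobs i = xobs j)"
    and "berkson_logistic M1 N xobs \<tau>2 \<beta>1 U1 Y1"
    and "berkson_logistic M2 N xobs \<tau>2 \<beta>2 U2 Y2"
    and "observation_law M1 N Y1 = observation_law M2 N Y2"
  shows "\<beta>1 = \<beta>2"
proof -
  interpret m1: berkson_logistic M1 N xobs \<tau>2 \<beta>1 U1 Y1 by fact
  interpret m2: berkson_logistic M2 N xobs \<tau>2 \<beta>2 U2 Y2 by fact
  obtain i j where ij: "i \<in> {1..N}" "j \<in> {1..N}" "xobs i \<noteq> xobs j"
    using assms(2) by blast
  \<comment> \<open>Equal joint laws give the same measure to the cylinder set of trial
    \<open>n\<close>, and under each model this measure is the corresponding
    \<open>response_prob\<close>.\<close>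
  have "response_prob \<tau>2 \<beta>1 (xobs n) = response_prob \<tau>2 \<beta>2 (xobs n)" if "n \<in> {1..N}" for n
    using m1.measure_observation_law[OF that] m2.measure_observation_law[OF that]
    unfolding assms(5) m1.prob_response[OF that assms(1)] m2.prob_response[OF that assms(1)]
    by simp
  then show ?thesis
    using ij by (intro response_prob_inject[OF assms(1) ij(3)]) auto
qed

end
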